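(* Let $S$ be a numerical semigroup with multiplicity $m$ and Frobenius number $F$. Then $S$ is $m$-irreducible if and only if $\mathrm{g}(S) = \mathrm{g}(m,F)$, where $\mathrm{g}(m,F)$ is the minimum genus among all numerical semigroups with multiplicity $m$ and Frobenius number $F$.
   Context: $\mathbb{N}$ denotes the set of nonnegative integers. A numerical semigroup is a subset $S \subseteq \mathbb{N}$ closed under addition, containing $0$, and such that $\mathbb{N}\setminus S$ is finite. The multiplicity of $S$ is the least positive integer belonging to $S$. The Frobenius number $\mathrm{F}(S)$ is the largest integer not belonging to $S$ (so $\mathrm{F}(\mathbb{N})=-1$). The genus $\mathrm{g}(S)$ is the cardinality of $\mathbb{N}\setminus S$. $\mathcal{S}(m)$ denotes the set of numerical semigroups with multiplicity $m$, and $\mathcal{S}(m,F)$ the set of those with multiplicity $m$ and Frobenius number $F$; when this set is nonempty, $\mathrm{g}(m,F) = \min\{\mathrm{g}(T) : T \in \mathcal{S}(m,F)\}$. An element $S \in \mathcal{S}(m)$ is $m$-irreducible if it cannot be expressed as the intersection of two elements of $\mathcal{S}(m)$ each containing $S$ properly. *)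

theory Defs
  imports Main
begin

definition numerical_semigroup :: "nat set \<Rightarrow> bool" where
  "numerical_semigroup S \<longleftrightarrow>
     0 \<in> S \<and> (\<forall>x\<in>S. \<forall>y\<in>S. x + y \<in> S) \<and> finite (UNIV - S)"

definition sg_multiplicity :: "nat set \<Rightarrow> nat" where
  "sg_multiplicity S = (LEAST n. n > 0 \<and> n \<in> S)"

text \<open>The maximum is over the integers, so that \<open>UNIV\<close> has Frobenius number \<open>-1\<close>.\<close>

definition frobenius_number :: "nat set \<Rightarrow> int" where
  "frobenius_number S = (GREATEST x. x \<notin> int ` S)"

definition genus :: "nat set \<Rightarrow> nat" where
  "genus S = card (UNIV - S)"

definition semigroups_mult :: "nat \<Rightarrow> nat set set" where
  "semigroups_mult m = {S. numerical_semigroup S \<and> sg_multiplicity S = m}"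

definition semigroups_mult_frob :: "nat \<Rightarrow> int \<Rightarrow> nat set set" where
  "semigroups_mult_frob m F =
     {S. numerical_semigroup S \<and> sg_multiplicity S = m \<and> frobenius_number S = F}"

text \<open>Only meaningful when \<open>semigroups_mult_frob m F\<close> is nonempty.\<close>

definition min_genus :: "nat \<Rightarrow> int \<Rightarrow> nat" where
  "min_genus m F = (LEAST g. \<exists>T\<in>semigroups_mult_frob m F. g = genus T)"

definition mult_irreducible :: "nat \<Rightarrow> nat set \<Rightarrow> bool" where
  "mult_irreducible m S \<longleftrightarrow>
     S \<in> semigroups_mult m \<and>
     \<not> (\<exists>A\<in>semigroups_mult m. \<exists>B\<in>semigroups_mult m. S \<subset> A \<and> S \<subset> B \<and> S = A \<inter> B)"

end

(* Irreducibility makes S almost symmetric: if some h > m with 2h > F has h and F - h both outside S,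
   then for the largest such h both insert h S and insert F S are semigroups of multiplicity m, and
   they intersect in S. Hence for an irreducible S and any competitor T with the same m and F, the
   map x \<mapsto> F - x sends T - S injectively into S - T, so S has at most as many gaps as T.
   Conversely, if S = A \<inter> B nontrivially, then F is missing from A or B, and that factor is a
   competitor with smaller genus. *)

theory Submission
  imports Defs
begin

text \<open>A cofinite set of naturals is infinite, so it has a positive element and the
  \<open>LEAST\<close> is attained.\<close>

lemma sg_multiplicity_eq_iff:
  assumes "numerical_semigroup S"
  shows "sg_multiplicity S = m \<longleftrightarrow> m > 0 \<and> m \<in> S \<and> (\<forall>n\<in>S. n > 0 \<longrightarrow> m \<le> n)"
proof -
  have "infinite S"
    using assms unfolding numerical_semigroup_def
    by (metis Diff_infinite_finite infinite_UNIV_nat)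
  then have "\<not> S \<subseteq> {0}"
    using finite_subset by blast
  then have ex: "\<exists>n. n > 0 \<and> n \<in> S"
    by auto
  show ?thesis
  proof
    assume "sg_multiplicity S = m"
    then show "m > 0 \<and> m \<in> S \<and> (\<forall>n\<in>S. n > 0 \<longrightarrow> m \<le> n)"
      using LeastI_ex[OF ex] Least_le[of "\<lambda>n. n > 0 \<and> n \<in> S"]
      unfolding sg_multiplicity_def by blast
  next
    assume "m > 0 \<and> m \<in> S \<and> (\<forall>n\<in>S. n > 0 \<longrightarrow> m \<le> n)"
    then show "sg_multiplicity S = m"
      unfolding sg_multiplicity_def by (intro Least_equality) auto
  qed
qed

lemma frobenius_number_eq_iff:
  assumes "numerical_semigroup S"
  shows "frobenius_number S = F \<longleftrightarrow> F \<notin> int ` S \<and> (\<forall>x>F. x \<in> int ` S)"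
proof -
  have eq: "frobenius_number S = G" if "G \<notin> int ` S" "\<forall>x>G. x \<in> int ` S" for G
    unfolding frobenius_number_def using that by (intro Greatest_equality) (auto intro: leI)
  define M where "M = Max (insert (-1) (int ` (UNIV - S)))"
  have fin: "finite (insert (-1) (int ` (UNIV - S)))"
    using assms unfolding numerical_semigroup_def by simp
  have "M \<in> insert (-1) (int ` (UNIV - S))"
    unfolding M_def using fin by (intro Max_in) auto
  then have M1: "M \<notin> int ` S" by auto
  have M2: "x \<in> int ` S" if "x > M" for x
  proof (rule ccontr)
    assume "x \<notin> int ` S"
    have "x > -1" using that fin Max_ge[OF fin, of "-1"] unfolding M_def by simp
    then obtain n where n: "x = int n" using nonneg_int_cases[of x] by auto
    with \<open>x \<notin> int ` S\<close> have "x \<in> int ` (UNIV - S)" by auto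
    then have "x \<le> M" unfolding M_def using fin by (intro Max_ge) auto
    with that show False by simp
  qed
  show ?thesis using eq M1 M2 by metis
qed

text \<open>The only new sums are \<open>h + h\<close> and \<open>h + s\<close>. For
  \<open>s = 0\<close> the latter is the adjoined element itself, hence the restriction to
  \<open>s > 0\<close>. Taking \<open>h > m\<close> preserves the multiplicity.\<close>

lemma insert_in_semigroups_mult:
  assumes S: "S \<in> semigroups_mult m" and "h > m" and "2 * h \<in> S"
    and add: "\<And>s. s \<in> S \<Longrightarrow> s > 0 \<Longrightarrow> h + s \<in> S"
  shows "insert h S \<in> semigroups_mult m"
proof -
  have nS: "numerical_semigroup S" and mS: "sg_multiplicity S = m"
    using S by (auto simp: semigroups_mult_def)
  have add': "h + s \<in> insert h S" if "s \<in> S" for s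
    using add[OF that] by (cases "s = 0") auto
  have "x + y \<in> insert h S" if "x \<in> insert h S" "y \<in> insert h S" for x y
    using that add'[of x] add'[of y] nS \<open>2 * h \<in> S\<close>
    by (auto simp: numerical_semigroup_def add.commute mult_2)
  then have "numerical_semigroup (insert h S)"
    using nS unfolding numerical_semigroup_def by (auto intro: finite_subset[of _ "UNIV - S"])
  then show ?thesis
    using mS \<open>h > m\<close> sg_multiplicity_eq_iff[OF nS] sg_multiplicity_eq_iff[of "insert h S"]
    by (auto simp: semigroups_mult_def)
qed

lemma mult_irreducible_reflection:
  fixes f :: nat
  assumes irr: "mult_irreducible m S" and F: "frobenius_number S = int f"
    and "h > m" "f < 2 * h" "h \<le> f" "h \<notin> S"
  shows "f - h \<in> S"
proof (rule ccontr)
  assume neg: "f - h \<notin> S"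
  have S: "S \<in> semigroups_mult m" using irr by (simp add: mult_irreducible_def)
  then have nS: "numerical_semigroup S" by (simp add: semigroups_mult_def)
  then have zero: "0 \<in> S" and plus: "\<And>x y. x \<in> S \<Longrightarrow> y \<in> S \<Longrightarrow> x + y \<in> S"
    by (auto simp: numerical_semigroup_def)
  have F': "int f \<notin> int ` S" "\<forall>x>int f. x \<in> int ` S"
    using F frobenius_number_eq_iff[OF nS, of "int f"] by simp_all
  have f: "f \<notin> S" using F'(1) by auto
  have above: "x \<in> S" if "x > f" for x
    using F'(2)[rule_format, of "int x"] that by auto
  let ?P = "\<lambda>k. k > m \<and> f < 2 * k \<and> k \<le> f \<and> k \<notin> S \<and> f - k \<notin> S"
  have "?P h" using assms neg by simp
  then have "?P (Greatest ?P)" by (rule GreatestI_nat[of ?P h f]) simp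
  moreover have "j \<le> Greatest ?P" if "?P j" for j
    using that by (rule Greatest_le_nat[of ?P j f]) simp
  ultimately obtain k where k: "?P k" and max: "\<And>j. ?P j \<Longrightarrow> j \<le> k"
    by blast
  \<comment> \<open>The reflection of \<open>f\<close> is 0, which lies in \<open>S\<close>, so
    \<open>f\<close> does not satisfy \<open>?P\<close>. This makes the two one-point extensions
    below distinct.\<close>
  have "k \<noteq> f" using k zero by auto
  \<comment> \<open>If \<open>k + s\<close> were a gap, maximality of \<open>k\<close> would put its
    reflection \<open>f - (k + s)\<close> into \<open>S\<close>; adding \<open>s\<close> would then
    give \<open>f - k \<in> S\<close>.\<close>
  have "k + s \<in> S" if "s \<in> S" "s > 0" for s
  proof (rule ccontr)
    assume ns: "k + s \<notin> S"
    then have "k + s \<le> f" using above[of "k + s"] by linarith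
    moreover have "\<not> k + s \<le> k" using \<open>s > 0\<close> by simp
    then have "\<not> ?P (k + s)" using max by blast
    then have "f - (k + s) \<in> S" using k ns \<open>k + s \<le> f\<close> by simp
    ultimately have "f - k \<in> S" using plus[OF _ \<open>s \<in> S\<close>, of "f - (k + s)"] by simp
    with k show False by blast
  qed
  then have "insert k S \<in> semigroups_mult m"
    using k above by (intro insert_in_semigroups_mult[OF S]) auto
  \<comment> \<open>Both \<open>2 * f\<close> and every \<open>f + s\<close> with
    \<open>s > 0\<close> exceed \<open>f\<close>, hence lie in \<open>S\<close>; and
    \<open>f > m\<close> because \<open>m < k \<le> f\<close>.\<close>
  moreover have "insert f S \<in> semigroups_mult m"
    using k above by (intro insert_in_semigroups_mult[OF S]) auto
  moreover have "S = insert k S \<inter> insert f S" using \<open>k \<noteq> f\<close> by auto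
  moreover have "S \<subset> insert k S" "S \<subset> insert f S" using k f by auto
  ultimately show False using irr unfolding mult_irreducible_def by blast
qed

text \<open>The gaps of \<open>S\<close> are the common gaps together with \<open>T - S\<close>, and
  those of \<open>T\<close> are the common gaps together with \<open>S - T\<close>. Only the two
  differences need comparing.\<close>

lemma genus_le_if_inj_on_Diff:
  assumes "numerical_semigroup S" "numerical_semigroup T"
    and "inj_on \<phi> (T - S)" "\<phi> ` (T - S) \<subseteq> S - T"
  shows "genus S \<le> genus T"
proof -
  let ?C = "UNIV - (S \<union> T)"
  have fin: "finite (UNIV - S)" "finite (UNIV - T)"
    using assms by (auto simp: numerical_semigroup_def)
  have finD: "finite (T - S)" "finite (S - T)" "finite ?C"
    using fin by (auto elim: rev_finite_subset)
  have "genus S = card (?C \<union> (T - S))" "genus T = card (?C \<union> (S - T))"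
    unfolding genus_def by (rule arg_cong[where f = card]; blast)+
  then have "genus S = card ?C + card (T - S)" "genus T = card ?C + card (S - T)"
    using finD by (auto simp: card_Un_disjoint Int_Un_distrib2 disjoint_iff)
  moreover have "card (T - S) \<le> card (S - T)"
    using assms finD by (intro card_inj_on_le)
  ultimately show ?thesis by simp
qed

lemma mult_irreducible_genus_le:
  assumes irr: "mult_irreducible m S" and F: "frobenius_number S = F"
    and T: "T \<in> semigroups_mult_frob m F"
  shows "genus S \<le> genus T"
proof -
  have nS: "numerical_semigroup S" and mS: "sg_multiplicity S = m"
    using irr by (auto simp: mult_irreducible_def semigroups_mult_def)
  have nT: "numerical_semigroup T" and mT: "sg_multiplicity T = m" and FT: "frobenius_number T = F"
    using T by (auto simp: semigroups_mult_frob_def)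
  have FnT: "F \<notin> int ` T" using frobenius_number_eq_iff[OF nT, of F] FT by simp
  have *: "int t \<le> F \<and> nat F - t \<in> S - T" if t: "t \<in> T - S" for t
  proof -
    have "int t \<notin> int ` S" using t by auto
    then have le: "int t \<le> F" using frobenius_number_eq_iff[OF nS, of F] F by (auto intro: leI)
    \<comment> \<open>The bound \<open>0 \<le> int t \<le> F\<close> shows that \<open>nat F\<close>
      is \<open>F\<close> itself and not the default 0.\<close>
    then have Ff: "F = int (nat F)" by simp
    have le': "t \<le> nat F" using le by simp
    have f: "nat F \<notin> T" using FnT Ff imageI[of "nat F" T int] by auto
    have plus: "\<And>x y. x \<in> T \<Longrightarrow> y \<in> T \<Longrightarrow> x + y \<in> T"
      using nT by (auto simp: numerical_semigroup_def)
    \<comment> \<open>Otherwise \<open>t\<close> and its reflection would sum to \<open>F\<close>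
      inside \<open>T\<close>.\<close>
    have refl: "nat F - t \<notin> T" using plus[of t "nat F - t"] t f le' by auto
    have "0 \<in> S" "m \<in> S" using nS sg_multiplicity_eq_iff[OF nS, of m] mS
      by (simp_all add: numerical_semigroup_def)
    then have "t > 0" "t \<noteq> m" using t by (auto intro: gr0I)
    moreover have "m \<le> t" using sg_multiplicity_eq_iff[OF nT, of m] mT t \<open>t > 0\<close> by simp
    ultimately have "t > m" by simp
    \<comment> \<open>The midpoint must be excluded, since the reflection property only concerns
      elements strictly above \<open>F / 2\<close>.\<close>
    have "2 * t \<noteq> nat F" using plus[of t t] t f by (auto simp: mult_2)
    have "nat F - t \<in> S"
    proof (rule ccontr)
      assume n: "nat F - t \<notin> S"
      show False
      \<comment> \<open>Reflection is applied to whichever of \<open>t\<close> and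
        \<open>nat F - t\<close> is the larger. In the second case it yields
        \<open>t \<in> S\<close>, contrary to the choice of \<open>t\<close>.\<close>
      proof (cases "nat F < 2 * t")
        case True
        then show False
          using mult_irreducible_reflection[OF irr, of "nat F" t] F Ff \<open>t > m\<close> le' t n by simp
      next
        case False
        then have "nat F < 2 * (nat F - t)" "m < nat F - t"
          using \<open>2 * t \<noteq> nat F\<close> \<open>t > m\<close> by auto
        then show False
          using mult_irreducible_reflection[OF irr, of "nat F" "nat F - t"] F Ff n le' t by simp
      qed
    qed
    with le refl show ?thesis by blast
  qed
  show ?thesis
  proof (rule genus_le_if_inj_on_Diff[OF nS nT])
    show "inj_on (\<lambda>t. nat F - t) (T - S)"
    proof (rule inj_onI)
      fix x y assume "x \<in> T - S" "y \<in> T - S" "nat F - x = nat F - y"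
      \<comment> \<open>Truncated subtraction is injective here because \<open>x\<close> and
        \<open>y\<close> are at most \<open>F\<close>.\<close>
      then show "x = y" using *[of x] *[of y] by linarith
    qed
    show "(\<lambda>t. nat F - t) ` (T - S) \<subseteq> S - T" using * by blast
  qed
qed

lemma mult_irreducible_if_genus_le:
  assumes S: "S \<in> semigroups_mult_frob m F"
    and min: "\<And>T. T \<in> semigroups_mult_frob m F \<Longrightarrow> genus S \<le> genus T"
  shows "mult_irreducible m S"
proof -
  have nS: "numerical_semigroup S" and mS: "sg_multiplicity S = m" and FS: "frobenius_number S = F"
    using S by (auto simp: semigroups_mult_frob_def)
  have F: "F \<notin> int ` S" "\<forall>x>F. x \<in> int ` S"
    using frobenius_number_eq_iff[OF nS, of F] FS by simp_all
  \<comment> \<open>Everything above \<open>F\<close> is already in \<open>S\<close>, so an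
    extension \<open>A\<close> still missing \<open>F\<close> has Frobenius number \<open>F\<close>.
    It would be a competitor with strictly fewer gaps.\<close>
  have *: "F \<in> int ` A" if A: "A \<in> semigroups_mult m" "S \<subset> A" for A
  proof (rule ccontr)
    assume "F \<notin> int ` A"
    moreover have nA: "numerical_semigroup A" using A by (simp add: semigroups_mult_def)
    moreover have "int ` S \<subseteq> int ` A" using A by (intro image_mono) auto
    ultimately have "frobenius_number A = F"
      using F(2) frobenius_number_eq_iff[OF nA, of F] by (simp add: subset_iff)
    then have "A \<in> semigroups_mult_frob m F"
      using A by (simp add: semigroups_mult_def semigroups_mult_frob_def)
    then have "genus S \<le> genus A" by (rule min)
    moreover have "genus A < genus S"
      unfolding genus_def using nS A by (intro psubset_card_mono) (auto simp: numerical_semigroup_def)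
    ultimately show False by simp
  qed
  have "F \<in> int ` S" if "A \<in> semigroups_mult m" "B \<in> semigroups_mult m"
    "S \<subset> A" "S \<subset> B" "S = A \<inter> B" for A B
    using *[OF that(1,3)] *[OF that(2,4)] that(5) by auto
  with F have "\<not> (\<exists>A\<in>semigroups_mult m. \<exists>B\<in>semigroups_mult m. S \<subset> A \<and> S \<subset> B \<and> S = A \<inter> B)"
    by blast
  then show ?thesis
    using nS mS by (simp add: mult_irreducible_def semigroups_mult_def)
qed

text \<open>Membership of \<open>S\<close> makes the family nonempty, so the \<open>LEAST\<close> in
  \<open>min_genus\<close> is a true minimum.\<close>

lemma genus_eq_min_genus_iff:
  assumes "S \<in> semigroups_mult_frob m F"
  shows "genus S = min_genus m F \<longleftrightarrow> (\<forall>T\<in>semigroups_mult_frob m F. genus S \<le> genus T)"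
proof
  assume "genus S = min_genus m F"
  then show "\<forall>T\<in>semigroups_mult_frob m F. genus S \<le> genus T"
    unfolding min_genus_def by (auto intro: Least_le)
next
  assume "\<forall>T\<in>semigroups_mult_frob m F. genus S \<le> genus T"
  then show "genus S = min_genus m F"
    unfolding min_genus_def using assms by (intro Least_equality[symmetric]) auto
qed

theorem theorem10:
  fixes S :: "nat set" and m :: nat and F :: int
  assumes "numerical_semigroup S" and "sg_multiplicity S = m" and "frobenius_number S = F"
  shows "mult_irreducible m S \<longleftrightarrow> genus S = min_genus m F"
proof -
  have S: "S \<in> semigroups_mult_frob m F"
    using assms by (simp add: semigroups_mult_frob_def)
  show ?thesis
    unfolding genus_eq_min_genus_iff[OF S]
    using mult_irreducible_genus_le[OF _ assms(3)] mult_irreducible_if_genus_le[OF S] by blast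
qed

end
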